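(* Let $R$ be a PID and let $I$ be a nonzero ideal of $R$. Then every element of $R/I$ is $I$-invertible.
   Context: Let $k:=\gcd(I)$ be a (fixed, arbitrary) greatest common divisor in $R$ of all elements of $I$; $k\neq 0$. For $r\in R$, $\hat r$ denotes its image in $R/I$. The notation $\gcd(a,b)=c$ means that $c$ is a greatest common divisor of $a,b$ (gcds are determined up to associates). An $I$-pre-image of an element $\hat b\in R/I$ is a pre-image of $\hat b$ in $R$ written in the form $r\delta$ with $r,\delta\in R$, $\gcd(r,k)=1$, and ($\delta=0$ or $\delta\mid k$); if $\hat b=\hat 0$, one takes $\delta:=0$. Here $r$ is called the relative prime part and $\delta$ the divisor part of the $I$-pre-image $r\delta$. The element $\hat b$ is called $I$-invertible if $\hat r$ is invertible in $R/I$ for at least one $I$-pre-image $r\delta$ of $\hat b$. *)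

theory Defs
  imports "HOL-Algebra.Ring_Divisibility"
begin

text \<open>The analogue of \<^const>\<open>isgcd\<close> for an arbitrary set of elements.\<close>

definition is_gcd_of_set :: "('a, 'b) ring_scheme \<Rightarrow> 'a \<Rightarrow> 'a set \<Rightarrow> bool" where
  "is_gcd_of_set R k A \<longleftrightarrow>
     k \<in> carrier R \<and> (\<forall>a\<in>A. k divides\<^bsub>R\<^esub> a) \<and>
     (\<forall>d\<in>carrier R. (\<forall>a\<in>A. d divides\<^bsub>R\<^esub> a) \<longrightarrow> d divides\<^bsub>R\<^esub> k)"

lemma is_gcd_of_set_iff_is_glb:
  assumes "A \<subseteq> carrier R"
  shows "is_gcd_of_set R k A \<longleftrightarrow> is_glb (division_rel R) k A"
proof -
  have "a \<in> A \<and> a \<in> carrier R \<longleftrightarrow> a \<in> A" for a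
    using assms by blast
  then show ?thesis
    by (auto simp: is_gcd_of_set_def greatest_def Lower_def)
qed

text \<open>
  In the following, \<open>k\<close> is a greatest common divisor of all elements of \<open>I\<close>, passed explicitly since
  it is only determined up to associates. The pre-image \<open>r\<delta>\<close> is represented by the pair of
  \<open>r\<close> and \<open>\<delta>\<close>, because the relative prime part and the divisor part are not determined by the product.
  The last conjunct forces \<open>\<delta> = 0\<close> for the zero class, where otherwise \<open>\<delta>\<close> could also be
  an associate of \<open>k\<close>.
\<close>

definition I_preimage ::
  "('a, 'b) ring_scheme \<Rightarrow> 'a set \<Rightarrow> 'a \<Rightarrow> 'a set \<Rightarrow> 'a \<Rightarrow> 'a \<Rightarrow> bool" where
  "I_preimage R I k b r \<delta> \<longleftrightarrow>
     r \<in> carrier R \<and> \<delta> \<in> carrier R \<and>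
     I +>\<^bsub>R\<^esub> (r \<otimes>\<^bsub>R\<^esub> \<delta>) = b \<and>
     \<one>\<^bsub>R\<^esub> gcdof\<^bsub>R\<^esub> r k \<and>
     (\<delta> = \<zero>\<^bsub>R\<^esub> \<or> \<delta> divides\<^bsub>R\<^esub> k) \<and>
     (b = \<zero>\<^bsub>R Quot I\<^esub> \<longrightarrow> \<delta> = \<zero>\<^bsub>R\<^esub>)"

definition I_invertible ::
  "('a, 'b) ring_scheme \<Rightarrow> 'a set \<Rightarrow> 'a \<Rightarrow> 'a set \<Rightarrow> bool" where
  "I_invertible R I k b \<longleftrightarrow>
     (\<exists>r \<delta>. I_preimage R I k b r \<delta> \<and> I +>\<^bsub>R\<^esub> r \<in> Units (R Quot I))"

end

theory Submission
  imports Defs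
begin

text \<open>
  A generator of \<open>I\<close> is the same up to a unit as \<open>k\<close>, so \<open>I = (k)\<close>, and \<open>r\<close> is invertible modulo
  \<open>I\<close> as soon as \<open>gcd(r, k) = 1\<close>. Given a representative \<open>a\<close> of a nonzero class, put
  \<open>\<delta> = gcd(a, k)\<close>, \<open>a = \<delta> a'\<close>, \<open>k = \<delta> m\<close>. The elements \<open>(a' + m t) \<delta>\<close> all represent the class,
  and as \<open>a'\<close> and \<open>m\<close> are coprime, one may choose \<open>t\<close> such that \<open>a' + m t\<close> is prime to \<open>k\<close>:
  this is shown by adding the irreducible factors of \<open>k\<close> one at a time.
\<close>

text \<open>Coprimality is encoded as a Bezout identity because such identities can be multiplied
  out in any commutative ring; in a principal ideal domain this agrees with having gcd
  \<open>\<one>\<close>.\<close>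

definition comaximal :: "('a, 'b) ring_scheme \<Rightarrow> 'a \<Rightarrow> 'a \<Rightarrow> bool" where
  "comaximal R a b \<longleftrightarrow>
     (\<exists>x\<in>carrier R. \<exists>y\<in>carrier R. x \<otimes>\<^bsub>R\<^esub> a \<oplus>\<^bsub>R\<^esub> y \<otimes>\<^bsub>R\<^esub> b = \<one>\<^bsub>R\<^esub>)"

section \<open>Calculus with Bezout identities in commutative rings\<close>

context cring
begin

lemma mem_PIdl_sum_iff:
  "z \<in> PIdl a <+>\<^bsub>R\<^esub> PIdl b \<longleftrightarrow>
     (\<exists>x\<in>carrier R. \<exists>y\<in>carrier R. z = x \<otimes> a \<oplus> y \<otimes> b)"
  unfolding set_add_def' cgenideal_def by auto

lemma comaximal_commute:
  assumes "a \<in> carrier R" "b \<in> carrier R" "comaximal R a b"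
  shows "comaximal R b a"
  using assms unfolding comaximal_def by (metis a_comm m_closed)

lemma comaximal_one:
  assumes "a \<in> carrier R"
  shows "comaximal R a \<one>"
  unfolding comaximal_def using assms by (intro bexI[of _ \<zero>] bexI[of _ \<one>]) auto

text \<open>Inserting the identity for \<open>c\<close> as a factor \<open>\<one>\<close> into the
  term \<open>y \<otimes> b\<close> leaves a multiple of \<open>a\<close> plus a multiple of
  \<open>b \<otimes> c\<close>.\<close>

lemma comaximal_mult:
  assumes "a \<in> carrier R" "b \<in> carrier R" "c \<in> carrier R"
    and "comaximal R a b" "comaximal R a c"
  shows "comaximal R a (b \<otimes> c)"
proof -
  obtain x y where xy: "x \<in> carrier R" "y \<in> carrier R" "x \<otimes> a \<oplus> y \<otimes> b = \<one>"
    using assms(4) unfolding comaximal_def by blast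
  obtain u v where uv: "u \<in> carrier R" "v \<in> carrier R" "u \<otimes> a \<oplus> v \<otimes> c = \<one>"
    using assms(5) unfolding comaximal_def by blast
  have "\<one> = x \<otimes> a \<oplus> y \<otimes> b \<otimes> (u \<otimes> a \<oplus> v \<otimes> c)"
    using xy uv assms by simp
  also have "\<dots> = (x \<oplus> y \<otimes> b \<otimes> u) \<otimes> a \<oplus> y \<otimes> v \<otimes> (b \<otimes> c)"
    using xy(1,2) uv(1,2) assms(1-3) by (simp add: l_distr r_distr m_ac a_ac)
  finally show ?thesis
    using xy(1,2) uv(1,2) assms(1-3) unfolding comaximal_def by (metis add.m_closed m_closed)
qed

lemma comaximal_divides:
  assumes "a \<in> carrier R" "b \<in> carrier R" "comaximal R a c" "b divides c"
  shows "comaximal R a b"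
proof -
  obtain x y where xy: "x \<in> carrier R" "y \<in> carrier R" "x \<otimes> a \<oplus> y \<otimes> c = \<one>"
    using assms(3) unfolding comaximal_def by blast
  obtain e where e: "e \<in> carrier R" "c = b \<otimes> e"
    using assms(4) unfolding factor_def by blast
  have "x \<otimes> a \<oplus> (y \<otimes> e) \<otimes> b = \<one>"
    using xy e assms(2) by (simp add: m_ac)
  then show ?thesis
    using xy e unfolding comaximal_def by blast
qed

text \<open>The shift is absorbed by changing the coefficient of \<open>b\<close> from
  \<open>y\<close> to \<open>y \<ominus> x \<otimes> t\<close>.\<close>

lemma comaximal_add_mult:
  assumes "a \<in> carrier R" "b \<in> carrier R" "t \<in> carrier R" "comaximal R a b"
  shows "comaximal R (a \<oplus> b \<otimes> t) b"
proof -
  obtain x y where xy: "x \<in> carrier R" "y \<in> carrier R" "x \<otimes> a \<oplus> y \<otimes> b = \<one>"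
    using assms(4) unfolding comaximal_def by blast
  have "x \<otimes> (a \<oplus> b \<otimes> t) \<oplus> (y \<ominus> x \<otimes> t) \<otimes> b
      = x \<otimes> a \<oplus> y \<otimes> b \<oplus> (x \<otimes> (b \<otimes> t) \<ominus> x \<otimes> (b \<otimes> t))"
    using xy(1,2) assms(1-3) by (simp add: minus_eq l_distr r_distr l_minus r_minus m_ac a_ac)
  also have "\<dots> = \<one>"
    using xy assms(1-3) by (simp add: r_right_minus_eq)
  finally show ?thesis
    using xy(1,2) assms(3) unfolding comaximal_def by (metis m_closed minus_closed)
qed

lemma comaximal_common_divisor:
  assumes "a \<in> carrier R" "b \<in> carrier R" "d \<in> carrier R"
    and "comaximal R a b" "d divides a" "d divides b"
  shows "d \<in> Units R"
proof -
  obtain x y where xy: "x \<in> carrier R" "y \<in> carrier R" "x \<otimes> a \<oplus> y \<otimes> b = \<one>"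
    using assms(4) unfolding comaximal_def by blast
  obtain e f where "e \<in> carrier R" "a = d \<otimes> e" "f \<in> carrier R" "b = d \<otimes> f"
    using assms(5,6) unfolding factor_def by blast
  with xy assms(3) have "\<one> = d \<otimes> (x \<otimes> e \<oplus> y \<otimes> f)" "x \<otimes> e \<oplus> y \<otimes> f \<in> carrier R"
    by (simp_all add: r_distr m_ac)
  then show ?thesis
    using assms(3) divides_one unfolding factor_def by blast
qed

end

section \<open>Coprimality, shifts and units of the quotient in a principal ideal domain\<close>

context principal_domain
begin

text \<open>Both sides say that the ideal sum of \<open>(a)\<close> and \<open>(b)\<close> is the
  whole ring: a gcd generates this sum, and a Bezout identity puts \<open>\<one>\<close> into
  it.\<close>

lemma coprime_iff_comaximal:
  assumes "a \<in> carrier R" "b \<in> carrier R"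
  shows "\<one> gcdof a b \<longleftrightarrow> comaximal R a b"
proof -
  interpret S: ideal "PIdl a <+>\<^bsub>R\<^esub> PIdl b" R
    using add_ideals cgenideal_ideal assms by blast
  have "\<one> gcdof a b \<longleftrightarrow> PIdl a <+>\<^bsub>R\<^esub> PIdl b = carrier R"
    using ideal_sum_iff_gcd[OF assms one_closed] ideal_eq_carrier_iff[OF one_closed] by auto
  also have "\<dots> \<longleftrightarrow> \<one> \<in> PIdl a <+>\<^bsub>R\<^esub> PIdl b"
    using S.one_imp_carrier by auto
  also have "\<dots> \<longleftrightarrow> comaximal R a b"
    unfolding mem_PIdl_sum_iff comaximal_def by metis
  finally show ?thesis .
qed

text \<open>If a common divisor \<open>d\<close> of \<open>a\<close> and \<open>p\<close> had a unit
  cofactor in \<open>p\<close>, it would be an associate of \<open>p\<close>, and \<open>p\<close>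
  would divide \<open>a\<close>. By irreducibility \<open>d\<close> is therefore a unit.\<close>

lemma irreducible_comaximal:
  assumes "p \<in> carrier R" "ring_irreducible p" "a \<in> carrier R" "\<not> p divides a"
  shows "comaximal R a p"
proof -
  have "\<one> gcdof a p"
  proof -
    have "d divides \<one>" if d: "d \<in> carrier R" "d divides a" "d divides p" for d
    proof -
      obtain e where e: "e \<in> carrier R" "p = d \<otimes> e"
        using d(3) unfolding factor_def by blast
      have "e \<notin> Units R"
      proof
        assume "e \<in> Units R"
        then have "p \<sim> d"
          using e d(1) assms(1) ring_associated_iff m_comm by blast
        then show False
          using assms d unfolding associated_def by (meson divides_trans)
      qed
      then show ?thesis
        using ring_irreducibleE(5)[OF assms(1,2) d(1) e] d(1) divides_one by blast
    qed
    then show ?thesis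
      using assms one_divides unfolding isgcd_def by blast
  qed
  then show ?thesis
    using assms coprime_iff_comaximal by blast
qed

lemma exists_shift_comaximal_prod:
  assumes "a \<in> carrier R" "m \<in> carrier R" "comaximal R a m"
    and "set fs \<subseteq> carrier R" "\<forall>p\<in>set fs. ring_irreducible p"
  shows "\<exists>t\<in>carrier R. comaximal R (a \<oplus> m \<otimes> t) (foldr (\<otimes>) fs \<one>)"
  using assms(4,5)
proof (induction fs)
  case Nil
  then show ?case
    using comaximal_one assms(1,2) by (auto intro!: bexI[of _ \<zero>])
next
  case (Cons p fs)
  define K where "K = foldr (\<otimes>) fs \<one>"
  have K: "K \<in> carrier R"
    using Cons.prems(1) multlist_closed unfolding K_def by auto
  have p: "p \<in> carrier R" "ring_irreducible p"
    using Cons.prems by auto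
  obtain t where t: "t \<in> carrier R" "comaximal R (a \<oplus> m \<otimes> t) K"
    using Cons unfolding K_def by auto
  define b where "b = a \<oplus> m \<otimes> t"
  \<comment> \<open>Every shift by a multiple of \<open>m\<close> stays comaximal with
    \<open>m\<close>; this is what later keeps \<open>p\<close> from dividing
    \<open>m\<close>.\<close>
  have b: "b \<in> carrier R" "comaximal R b K" "comaximal R b m"
    using t assms comaximal_add_mult unfolding b_def by auto
  have "\<exists>s\<in>carrier R. comaximal R (b \<oplus> m \<otimes> s) (p \<otimes> K)"
  proof (cases "p divides b")
    case False
    then have "comaximal R b (p \<otimes> K)"
      using comaximal_mult irreducible_comaximal p b K by blast
    then show ?thesis
      using b assms(2) by (auto intro!: bexI[of _ \<zero>])
  next
    case True
    \<comment> \<open>An irreducible dividing \<open>b\<close> cannot divide anything comaximal with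
      \<open>b\<close>. In particular, a factor \<open>p\<close> that recurs in \<open>fs\<close>
      falls under the previous case.\<close>
    have "\<not> p divides m" "\<not> p divides K"
      using comaximal_common_divisor True p b K assms(2) ring_irreducibleE(4) by blast+
    then have "comaximal R m p" "comaximal R K p"
      using irreducible_comaximal p assms(2) K by blast+
    \<comment> \<open>As \<open>p\<close> divides \<open>b\<close> but not \<open>m K\<close>, the shift by \<open>m K\<close> repairs \<open>p\<close>, and it is harmless for \<open>K\<close>.\<close>
    have "\<not> p divides (b \<oplus> m \<otimes> K)"
    proof
      assume "p divides (b \<oplus> m \<otimes> K)"
      then obtain e f where ef: "e \<in> carrier R" "b \<oplus> m \<otimes> K = p \<otimes> e" "f \<in> carrier R" "b = p \<otimes> f"
        using True unfolding factor_def by blast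
      have "m \<otimes> K = (b \<oplus> m \<otimes> K) \<ominus> b"
        using b assms(2) K by (simp add: minus_eq a_ac r_neg1 r_neg2)
      also have "\<dots> = p \<otimes> (e \<ominus> f)"
        unfolding ef(2) using ef p by (simp add: minus_eq r_distr r_minus)
      finally have "p divides (m \<otimes> K)"
        using ef unfolding factor_def by blast
      \<comment> \<open>As a common divisor of the comaximal elements \<open>p\<close> and
        \<open>m \<otimes> K\<close>, the irreducible \<open>p\<close> would be a unit.\<close>
      moreover have "comaximal R p (m \<otimes> K)"
        using comaximal_mult comaximal_commute \<open>comaximal R m p\<close> \<open>comaximal R K p\<close>
          p(1) assms(2) K by blast
      ultimately show False
        using comaximal_common_divisor[of p "m \<otimes> K" p] p assms(2) K ring_irreducibleE(4)
        by simp
    qed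
    then have "comaximal R (b \<oplus> m \<otimes> K) p"
      using irreducible_comaximal[OF p] b(1) K assms(2) by simp
    moreover have "comaximal R (b \<oplus> m \<otimes> K) K"
      using comaximal_add_mult[of b K m] b K assms(2) m_comm by simp
    ultimately have "comaximal R (b \<oplus> m \<otimes> K) (p \<otimes> K)"
      using comaximal_mult[of "b \<oplus> m \<otimes> K" p K] b(1) K p(1) assms(2) by simp
    then show ?thesis
      using K by blast
  qed
  then obtain s where s: "s \<in> carrier R" "comaximal R (b \<oplus> m \<otimes> s) (p \<otimes> K)"
    by blast
  have "b \<oplus> m \<otimes> s = a \<oplus> m \<otimes> (t \<oplus> s)"
    using s t assms unfolding b_def by (simp add: r_distr a_ac)
  then show ?case
    using s t unfolding K_def by auto
qed

lemma exists_shift_comaximal: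
  assumes "a \<in> carrier R" "m \<in> carrier R" "comaximal R a m"
    and "k \<in> carrier R" "k \<noteq> \<zero>"
  shows "\<exists>t\<in>carrier R. comaximal R (a \<oplus> m \<otimes> t) k"
proof -
  \<comment> \<open>Factorizations live in \<open>mult_of R\<close>, the monoid of nonzero elements,
    and give \<open>k\<close> up to associates. So \<open>k\<close> divides the product of
    \<open>fs\<close>, and comaximality passes from the product to its divisor
    \<open>k\<close>.\<close>
  obtain fs where fs: "set fs \<subseteq> carrier (mult_of R)" "wfactors (mult_of R) fs k"
    using mult_of.wfactors_exist[of k] assms(4,5) by auto
  have "foldr (\<otimes>) fs \<one> \<sim>\<^bsub>mult_of R\<^esub> k" "\<forall>p\<in>set fs. irreducible (mult_of R) p"
    using fs(2) unfolding wfactors_def by auto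
  then have "k divides foldr (\<otimes>) fs \<one>" "\<forall>p\<in>set fs. ring_irreducible p"
    using fs(1) ring_irreducibleI' unfolding associated_def by auto
  moreover have "set fs \<subseteq> carrier R"
    using fs(1) by auto
  ultimately obtain t where t: "t \<in> carrier R"
      "comaximal R (a \<oplus> m \<otimes> t) (foldr (\<otimes>) fs \<one>)" "k divides foldr (\<otimes>) fs \<one>"
    using exists_shift_comaximal_prod[OF assms(1-3), of fs] by auto
  have "comaximal R (a \<oplus> m \<otimes> t) k"
    using comaximal_divides[OF _ assms(4) t(2,3)] t(1) assms(1,2) by simp
  then show ?thesis
    using t(1) by blast
qed

text \<open>A generator \<open>d\<close> of the ideal sum of \<open>(a)\<close> and
  \<open>(k)\<close> is a gcd and a combination of \<open>a\<close> and \<open>k\<close>. Cancelling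
  \<open>d\<close>, nonzero because \<open>k\<close> is, turns this combination into a Bezout
  identity for the cofactors.\<close>

lemma exists_gcd_cofactors:
  assumes "a \<in> carrier R" "k \<in> carrier R" "k \<noteq> \<zero>"
  obtains d b m where "d \<in> carrier R" "b \<in> carrier R" "m \<in> carrier R"
    and "a = d \<otimes> b" "k = d \<otimes> m" "comaximal R b m"
proof -
  have "ideal (PIdl a <+>\<^bsub>R\<^esub> PIdl k) R"
    using add_ideals cgenideal_ideal assms by blast
  then obtain d where d: "d \<in> carrier R" "PIdl a <+>\<^bsub>R\<^esub> PIdl k = PIdl d"
    using exists_gen by blast
  have "d gcdof a k"
    using ideal_sum_iff_gcd[OF assms(1,2) d(1)] d(2) by simp
  then obtain b m where bm: "b \<in> carrier R" "a = d \<otimes> b" "m \<in> carrier R" "k = d \<otimes> m"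
    unfolding isgcd_def factor_def by blast
  have "d \<in> PIdl a <+>\<^bsub>R\<^esub> PIdl k"
    using d cgenideal_self by simp
  then obtain x y where xy: "x \<in> carrier R" "y \<in> carrier R" "d = x \<otimes> a \<oplus> y \<otimes> k"
    unfolding mem_PIdl_sum_iff by blast
  have "d \<noteq> \<zero>"
    using bm assms(3) by auto
  moreover have "d \<otimes> (x \<otimes> b \<oplus> y \<otimes> m) = d \<otimes> \<one>"
  proof -
    have "d \<otimes> (x \<otimes> b \<oplus> y \<otimes> m) = x \<otimes> a \<oplus> y \<otimes> k"
      using d(1) xy(1,2) bm by (simp add: r_distr m_ac)
    then show ?thesis
      using xy(3) d(1) by simp
  qed
  ultimately have "x \<otimes> b \<oplus> y \<otimes> m = \<one>"
    using m_lcancel[of d "x \<otimes> b \<oplus> y \<otimes> m" \<one>] d(1) xy(1,2) bm by simp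
  then show thesis
    using that d(1) bm xy unfolding comaximal_def by blast
qed

lemma ideal_eq_PIdl_gcd:
  assumes "ideal I R" "is_gcd_of_set R k I"
  shows "I = PIdl k"
proof -
  obtain i where i: "i \<in> carrier R" "I = PIdl i"
    using exists_gen assms(1) by blast
  have "i divides c" if "c \<in> I" for c
    using that i m_comm unfolding i(2) cgenideal_def factor_def by auto
  moreover have "i \<in> I"
    using i cgenideal_self by simp
  \<comment> \<open>As a common divisor of \<open>I\<close>, the generator \<open>i\<close> divides
    \<open>k\<close>; as an element of \<open>I\<close>, it is divisible by
    \<open>k\<close>.\<close>
  ultimately have "k \<sim> i" "k \<in> carrier R"
    using assms(2) i(1) unfolding is_gcd_of_set_def associated_def by auto
  then show ?thesis
    using associated_iff_same_ideal i by blast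
qed

text \<open>Modulo \<open>k\<close> the term \<open>y \<otimes> k\<close> of the Bezout identity
  vanishes, so the coset of \<open>x\<close> is an inverse.\<close>

lemma comaximal_imp_quot_unit:
  assumes "r \<in> carrier R" "k \<in> carrier R" "comaximal R r k"
  shows "PIdl k +> r \<in> Units (R Quot PIdl k)"
proof -
  interpret J: ideal "PIdl k" R
    using cgenideal_ideal assms(2) .
  interpret Q: cring "R Quot PIdl k"
    using J.quotient_is_cring is_cring .
  interpret h: ring_hom_ring R "R Quot PIdl k" "(+>) (PIdl k)"
    using J.rcos_ring_hom_ring .
  obtain x y where xy: "x \<in> carrier R" "y \<in> carrier R" "x \<otimes> r \<oplus> y \<otimes> k = \<one>"
    using assms(3) unfolding comaximal_def by blast
  have "y \<otimes> k \<in> PIdl k"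
    using xy(2) unfolding cgenideal_def by blast
  then have "PIdl k +> (y \<otimes> k) = \<zero>\<^bsub>R Quot PIdl k\<^esub>"
    using a_rcos_zero[OF J.ideal_axioms] unfolding FactRing_def ring_record_simps by blast
  then have "(PIdl k +> x) \<otimes>\<^bsub>R Quot PIdl k\<^esub> (PIdl k +> r) = \<one>\<^bsub>R Quot PIdl k\<^esub>"
    using xy assms h.hom_add[of "x \<otimes> r" "y \<otimes> k"] by simp
  moreover have "PIdl k +> x \<in> carrier (R Quot PIdl k)" "PIdl k +> r \<in> carrier (R Quot PIdl k)"
    using xy assms by simp_all
  ultimately show ?thesis
    using Q.m_comm[of "PIdl k +> x" "PIdl k +> r"] unfolding Units_def by fastforce
qed

end

theorem corollary3p9:
  fixes R :: "('a, 'b) ring_scheme" (structure)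
    and I :: "'a set" and k :: 'a
  assumes "principal_domain R"
    and "ideal I R"
    and "I \<noteq> {\<zero>}"
    and "is_gcd_of_set R k I"
  shows "\<forall>b\<in>carrier (R Quot I). I_invertible R I k b"
proof
  interpret principal_domain R
    by fact
  interpret ideal I R
    by fact
  fix b assume "b \<in> carrier (R Quot I)"
  then obtain a where a: "a \<in> carrier R" "b = I +> a"
    unfolding FactRing_def A_RCOSETS_def' by auto
  have I: "I = PIdl k" and k: "k \<in> carrier R"
    using ideal_eq_PIdl_gcd assms(2,4) unfolding is_gcd_of_set_def by auto
  have "k \<noteq> \<zero>"
    using assms(3) unfolding I cgenideal_def by (auto intro: exI[of _ \<zero>])
  \<comment> \<open>Comaximality of \<open>r\<close> and \<open>k\<close> serves twice: it gives the
    gcd condition of an \<open>I\<close>-pre-image and the invertibility of the coset of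
    \<open>r\<close>.\<close>
  have invertibleI: "I_invertible R I k b"
    if "r \<in> carrier R" "\<delta> \<in> carrier R" "I +> r \<otimes> \<delta> = b" "comaximal R r k"
      "\<delta> = \<zero> \<or> \<delta> divides k" "b = \<zero>\<^bsub>R Quot I\<^esub> \<longrightarrow> \<delta> = \<zero>" for r \<delta>
  proof -
    have "I_preimage R I k b r \<delta>"
      using that coprime_iff_comaximal[OF that(1) k] unfolding I_preimage_def by simp
    moreover have "I +> r \<in> Units (R Quot I)"
      using comaximal_imp_quot_unit[OF that(1) k that(4)] unfolding I .
    ultimately show ?thesis
      unfolding I_invertible_def by blast
  qed
  show "I_invertible R I k b"
  proof (cases "b = \<zero>\<^bsub>R Quot I\<^esub>")
    case True
    \<comment> \<open>For the zero class \<delta> must be \<open>\<zero>\<close>, and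
      \<open>\<one>\<close> can be taken as relative prime part.\<close>
    have "comaximal R \<one> k"
      unfolding comaximal_def using k by (intro bexI[of _ \<one>] bexI[of _ \<zero>]) auto
    moreover have "I +> \<one> \<otimes> \<zero> = b"
      using True a_subset by (simp add: FactRing_def)
    ultimately show ?thesis
      using invertibleI[of \<one> \<zero>] by simp
  next
    case False
    obtain \<delta> c m where \<delta>: "\<delta> \<in> carrier R" "c \<in> carrier R" "m \<in> carrier R"
      "a = \<delta> \<otimes> c" "k = \<delta> \<otimes> m" "comaximal R c m"
      using exists_gcd_cofactors[OF a(1) k \<open>k \<noteq> \<zero>\<close>] .
    \<comment> \<open>The cofactor \<open>c\<close> is coprime to \<open>m\<close> but may share
      factors with \<open>k\<close>. The shift removes them and changes the product with \<delta>
      only by \<open>t \<otimes> k\<close>, an element of \<open>I\<close>.\<close>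
    obtain t where t: "t \<in> carrier R" "comaximal R (c \<oplus> m \<otimes> t) k"
      using exists_shift_comaximal \<delta> k \<open>k \<noteq> \<zero>\<close> by blast
    have "(c \<oplus> m \<otimes> t) \<otimes> \<delta> = t \<otimes> k \<oplus> a"
      using \<delta>(1-5) t(1) by (simp add: r_distr m_ac a_ac)
    moreover have "t \<otimes> k \<in> I"
      using t(1) unfolding I cgenideal_def by blast
    ultimately have "(c \<oplus> m \<otimes> t) \<otimes> \<delta> \<in> I +> a"
      unfolding a_r_coset_def' by auto
    then have "I +> (c \<oplus> m \<otimes> t) \<otimes> \<delta> = b"
      using a a_repr_independence' by simp
    moreover have "\<delta> divides k"
      using \<delta> unfolding factor_def by blast
    ultimately show ?thesis
      using invertibleI[of "c \<oplus> m \<otimes> t" \<delta>] \<delta> t False by simp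
  qed
qed

end
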